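(* Let $f=h+\bar g\in\mathcal{S}_{\mathcal H}^0$ be such that $h\in\mathcal{S}^*(\psi)$ and $g(z)=\varphi(z)h(z)$ in $\mathbb{D}$ for some $\varphi\in\mathcal{B}_s$. Let $h_\psi(z)=z\exp\left(\int_0^z\frac{\psi(t)-1}{t}\,dt\right)$. Then $f$ is uniformly starlike on the disk $|z|<r_{us}=\min\{1/3,r_\psi\}$, where $r_\psi$ is the smallest positive root in $(0,1)$ of the equation $$h_\psi'(r)-\frac54=0.$$
   Context: $\mathbb{D}=\{z:|z|<1\}$. $\mathcal{S}_{\mathcal H}^0$ is the class of harmonic, univalent, sense-preserving $f=h+\bar g$ in $\mathbb{D}$ ($h,g$ analytic) with $h(z)=z+\sum_{n\ge2}a_nz^n$, $g(z)=\sum_{n\ge2}b_nz^n$. $\psi$ is a univalent analytic function in $\mathbb{D}$ with $\psi(z)=1+p_1z+\cdots$ and $\Re\psi>0$; as a standing assumption its Taylor coefficients are positive. $\mathcal{S}^*(\psi)$ is the class of analytic $h$ in $\mathbb{D}$ with $h(0)=0$, $h'(0)=1$ and $zh'(z)/h(z)\prec\psi(z)$ (subordination). $\mathcal{B}_s$ is the class of analytic functions $\varphi:\mathbb{D}\to\mathbb{D}$. A locally univalent harmonic $f$ is uniformly starlike in a disk $|z|<\rho$ if it is fully starlike there (each circle $|z|=r<\rho$ is mapped one-to-one onto a curve bounding a domain starlike with respect to $0$, with $\frac{\partial}{\partial\theta}\arg f(re^{i\theta})>0$) and it maps every circular arc $\Gamma_\zeta$ contained in $|z|<\rho$ with center $\zeta$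 in $|z|<\rho$ onto an arc starlike with respect to $f(\zeta)$ (i.e. $\arg(f(z)-f(\zeta))$ is nondecreasing as $z$ traverses $\Gamma_\zeta$ in the positive direction). *)

theory Defs
  imports "HOL-Complex_Analysis.Complex_Analysis"
begin

abbreviation unit_disk :: "complex set" where
  "unit_disk \<equiv> ball 0 1"

(* The derivative is that of f as a map of the real plane; Im (cnj u * v) is the determinant
   with columns u, v, so the condition says that the Jacobian of f is positive. For
   f = h + cnj g it reads |h'|^2 - |g'|^2 > 0. *)
definition sense_preserving_on :: "(complex \<Rightarrow> complex) \<Rightarrow> complex set \<Rightarrow> bool" where
  "sense_preserving_on f S \<longleftrightarrow>
     (\<forall>z\<in>S. \<exists>L. (f has_derivative L) (at z) \<and> Im (cnj (L 1) * L \<i>) > 0)"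

definition SH0 :: "(complex \<Rightarrow> complex) \<Rightarrow> (complex \<Rightarrow> complex) \<Rightarrow> (complex \<Rightarrow> complex) \<Rightarrow> bool" where
  "SH0 f h g \<longleftrightarrow>
     h holomorphic_on unit_disk \<and> g holomorphic_on unit_disk \<and>
     (\<forall>z\<in>unit_disk. f z = h z + cnj (g z)) \<and>
     inj_on f unit_disk \<and> sense_preserving_on f unit_disk \<and>
     h 0 = 0 \<and> deriv h 0 = 1 \<and> g 0 = 0 \<and> deriv g 0 = 0"

definition admissible_psi :: "(complex \<Rightarrow> complex) \<Rightarrow> bool" where
  "admissible_psi \<psi> \<longleftrightarrow>
     \<psi> holomorphic_on unit_disk \<and> inj_on \<psi> unit_disk \<and> \<psi> 0 = 1 \<and>
     (\<forall>z\<in>unit_disk. Re (\<psi> z) > 0) \<and>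
     (\<forall>n. \<exists>p::real. p > 0 \<and> (deriv ^^ n) \<psi> 0 / fact n = of_real p)"

definition subordinate :: "(complex \<Rightarrow> complex) \<Rightarrow> (complex \<Rightarrow> complex) \<Rightarrow> bool" where
  "subordinate F G \<longleftrightarrow>
     (\<exists>\<omega>. \<omega> holomorphic_on unit_disk \<and> \<omega> ` unit_disk \<subseteq> unit_disk \<and> \<omega> 0 = 0 \<and>
          (\<forall>z\<in>unit_disk. F z = G (\<omega> z)))"

(* z h'(z) / h(z) is meant as an analytic function on the whole disk: h has no zeros besides 0,
   and the removable singularity at 0 is filled in with its limit 1. *)
definition S_star :: "(complex \<Rightarrow> complex) \<Rightarrow> (complex \<Rightarrow> complex) \<Rightarrow> bool" where
  "S_star \<psi> h \<longleftrightarrow>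
     h holomorphic_on unit_disk \<and> h 0 = 0 \<and> deriv h 0 = 1 \<and>
     (\<forall>z\<in>unit_disk - {0}. h z \<noteq> 0) \<and>
     subordinate (\<lambda>z. if z = 0 then 1 else z * deriv h z / h z) \<psi>"

definition Bs :: "(complex \<Rightarrow> complex) \<Rightarrow> bool" where
  "Bs \<phi> \<longleftrightarrow> \<phi> holomorphic_on unit_disk \<and> \<phi> ` unit_disk \<subseteq> unit_disk"

(* The integral runs along the segment from 0 to z; the value of the integrand at the single
   point 0 is irrelevant. *)
definition h_psi :: "(complex \<Rightarrow> complex) \<Rightarrow> complex \<Rightarrow> complex" where
  "h_psi \<psi> z = z * exp (contour_integral (linepath 0 z) (\<lambda>t. (\<psi> t - 1) / t))"

definition starlike_wrt :: "complex \<Rightarrow> complex set \<Rightarrow> bool" where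
  "starlike_wrt a D \<longleftrightarrow> a \<in> D \<and> (\<forall>w\<in>D. closed_segment a w \<subseteq> D)"

(* \<alpha> is a continuous choice of arg (\<gamma> t) for t in I. On an interval such a choice is unique up
   to an additive constant, so monotonicity and derivatives do not depend on it. *)
definition arg_branch :: "real set \<Rightarrow> (real \<Rightarrow> complex) \<Rightarrow> (real \<Rightarrow> real) \<Rightarrow> bool" where
  "arg_branch I \<gamma> \<alpha> \<longleftrightarrow>
     continuous_on I \<alpha> \<and> (\<forall>t\<in>I. \<gamma> t \<noteq> 0 \<and> \<gamma> t = of_real (cmod (\<gamma> t)) * cis (\<alpha> t))"

definition fully_starlike :: "(complex \<Rightarrow> complex) \<Rightarrow> real \<Rightarrow> bool" where
  "fully_starlike f \<rho> \<longleftrightarrow>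
     (\<forall>r. 0 < r \<and> r < \<rho> \<longrightarrow>
        inj_on f (sphere 0 r) \<and>
        (\<exists>D. open D \<and> connected D \<and> bounded D \<and> frontier D = f ` sphere 0 r \<and> starlike_wrt 0 D) \<and>
        (\<exists>\<alpha>. arg_branch UNIV (\<lambda>\<theta>. f (of_real r * cis \<theta>)) \<alpha> \<and>
             (\<forall>\<theta>. \<exists>d>0. (\<alpha> has_real_derivative d) (at \<theta>))))"

(* The notion is applied to locally univalent harmonic functions only. The circular arc with
   center \<zeta> and radius s is {\<zeta> + s e^(it) | a \<le> t \<le> b}, full circles included. *)
definition uniformly_starlike :: "(complex \<Rightarrow> complex) \<Rightarrow> real \<Rightarrow> bool" where
  "uniformly_starlike f \<rho> \<longleftrightarrow>
     fully_starlike f \<rho> \<and>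
     (\<forall>\<zeta> s a b. \<zeta> \<in> ball 0 \<rho> \<and> 0 < s \<and> a < b \<and> b \<le> a + 2 * pi \<and>
        (\<forall>t\<in>{a..b}. \<zeta> + of_real s * cis t \<in> ball 0 \<rho>) \<longrightarrow>
        (\<exists>\<alpha>. arg_branch {a..b} (\<lambda>t. f (\<zeta> + of_real s * cis t) - f \<zeta>) \<alpha> \<and> mono_on {a..b} \<alpha>))"

end

theory Submission
  imports Defs
begin

text \<open>Since \<open>\<psi>\<close> has positive Taylor coefficients, the Schwarz lemma gives
  \<open>\<bar>\<psi>(\<omega>(z)) - 1\<bar> \<le> \<psi>(r) - 1\<close> for \<open>\<bar>z\<bar> \<le> r\<close>. Writing \<open>h = z exp E\<close> with \<open>z E' = \<psi> \<circ> \<omega> - 1\<close>,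
  integration gives \<open>\<bar>h' - 1\<bar> \<le> h\<^sub>\<psi>'(r) - 1\<close>, which is at most \<open>1/4\<close> for \<open>r \<le> r\<^sub>\<psi>\<close>.
  The dilatation \<open>g'/h'\<close> maps the disk into itself and fixes \<open>0\<close>, so \<open>\<bar>g'\<bar> \<le> \<bar>z\<bar> \<bar>h'\<bar> \<le> 5/12\<close>
  for \<open>\<bar>z\<bar> \<le> 1/3\<close>. Hence \<open>f(z) - f(\<zeta>)\<close> and the derivative of \<open>f\<close> along an arc centred at \<open>\<zeta>\<close>
  (divided by \<open>\<i>\<close>), namely \<open>(z - \<zeta>) h'(z) - cnj ((z - \<zeta>) g'(z))\<close>, both lie within relative
  distance \<open>1/4 + 5/12 = 2/3\<close> of \<open>z - \<zeta>\<close>. As \<open>2/3 < 1 / sqrt 2\<close>, their arguments differ by less than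
  \<open>\<pi>/2\<close>, so \<open>arg (f(z) - f(\<zeta>))\<close> increases along the arc. The same estimate shows that
  \<open>f(z) = (1 + \<epsilon>) f(z\<^sub>0)\<close> with \<open>\<epsilon> > 0\<close> forces \<open>\<bar>z\<bar> > \<bar>z\<^sub>0\<bar>\<close>, so a segment from \<open>0\<close> to a point of
  \<open>f({\<bar>z\<bar> < r})\<close> cannot meet the boundary curve.\<close>

section \<open>Majorants for the exponential and for \<open>\<psi>\<close>\<close>

text \<open>Along \<open>x\<close> in \<open>{0..1}\<close> the derivative of
  \<open>exp (x * E)\<close> has norm \<open>cmod E * exp (x * Re E)\<close>, which is at most the
  derivative of \<open>exp (x * cmod E)\<close>.\<close>

lemma norm_exp_minus_one_le: "cmod (exp E - 1) \<le> exp (cmod E) - 1"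
proof -
  have "norm (exp (of_real 1 * E) - exp (of_real 0 * E)) \<le> exp (1 * cmod E) - exp (0 * cmod E)"
  proof (rule differentiable_bound_general[where f' = "\<lambda>x. E * exp (of_real x * E)"
        and \<phi>' = "\<lambda>x. cmod E * exp (x * cmod E)"])
    fix x :: real assume x: "0 < x" "x < 1"
    show "((\<lambda>x. exp (of_real x * E)) has_vector_derivative E * exp (of_real x * E)) (at x)"
      by (rule has_vector_derivative_real_field) (auto intro!: derivative_eq_intros)
    show "((\<lambda>x. exp (x * cmod E)) has_vector_derivative cmod E * exp (x * cmod E)) (at x)"
      unfolding has_real_derivative_iff_has_vector_derivative[symmetric]
      by (auto intro!: derivative_eq_intros)
    have "x * Re E \<le> x * cmod E"
      using x complex_Re_le_cmod[of E] by (intro mult_left_mono) auto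
    then show "norm (E * exp (of_real x * E)) \<le> cmod E * exp (x * cmod E)"
      by (simp add: norm_mult norm_exp_eq_Re mult_left_mono)
  qed (auto intro!: continuous_intros)
  then show ?thesis by simp
qed

text \<open>With positive coefficients, the triangle inequality applied termwise to the series
  without its constant term is sharp on the positive axis.\<close>

lemma admissible_psi_majorant:
  assumes "admissible_psi \<psi>" "cmod w \<le> r" "r < 1"
  shows "cmod (\<psi> w - 1) \<le> Re (\<psi> (of_real r)) - 1"
proof -
  let ?a = "\<lambda>n. (deriv ^^ n) \<psi> 0 / fact n"
  have hol: "\<psi> holomorphic_on ball 0 1" and \<psi>0: "\<psi> 0 = 1"
    and pos: "\<And>n. \<exists>p::real. p > 0 \<and> ?a n = of_real p"
    using assms(1) by (auto simp: admissible_psi_def)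
  obtain p :: "nat \<Rightarrow> real" where p: "\<And>n. p n > 0" "\<And>n. ?a n = of_real (p n)"
    using pos by metis
  have "r \<ge> 0" using assms(2) norm_ge_zero order_trans by blast
  have tail: "(\<lambda>n. of_real (p (Suc n)) * z ^ Suc n) sums (\<psi> z - 1)" if "cmod z < 1" for z
  proof -
    have "(\<lambda>n. ?a n * (z - 0) ^ n) sums \<psi> z"
      using that by (intro holomorphic_power_series[OF hol]) auto
    then have "(\<lambda>n. of_real (p n) * z ^ n) sums \<psi> z" by (simp add: p(2))
    moreover have "of_real (p 0) = (1::complex)" using p(2)[of 0] \<psi>0 by simp
    ultimately show ?thesis
      using sums_Suc_iff[of "\<lambda>n. of_real (p n) * z ^ n" "\<psi> z - 1"] by simp
  qed
  have "(\<lambda>n. of_real (p (Suc n)) * of_real r ^ Suc n) sums (\<psi> (of_real r) - 1)"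
    using \<open>r \<ge> 0\<close> assms(3) by (intro tail) auto
  from sums_Re[OF this] have "(\<lambda>n. p (Suc n) * r ^ Suc n) sums (Re (\<psi> (of_real r)) - 1)"
    by (simp flip: of_real_power of_real_mult)
  moreover have "cmod (of_real (p (Suc n)) * w ^ Suc n) \<le> p (Suc n) * r ^ Suc n" for n
    using p(1)[of "Suc n"] assms(2)
    by (simp only: norm_mult norm_power norm_of_real abs_of_pos)
       (intro mult_left_mono power_mono, auto)
  moreover have "(\<lambda>n. of_real (p (Suc n)) * w ^ Suc n) sums (\<psi> w - 1)"
    using assms(2,3) by (intro tail) auto
  ultimately show ?thesis using norm_sums_le by blast
qed

section \<open>Logarithmic representations and the bound on \<open>h'\<close>\<close>

text \<open>\<open>F z / z\<close> extends without zeros to the simply connected disk, so it has a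
  holomorphic logarithm \<open>E\<close>; differentiating \<open>F z = z * exp (E z)\<close> gives
  \<open>deriv E\<close>.\<close>

lemma holomorphic_log_quotient:
  assumes "F holomorphic_on ball 0 1" "F 0 = 0" "deriv F 0 = 1"
    and nz: "\<And>z. z \<in> ball 0 1 - {0} \<Longrightarrow> F z \<noteq> 0"
  obtains E where "E 0 = 0" "E holomorphic_on ball 0 1" "\<And>z. z \<in> ball 0 1 \<Longrightarrow> F z = z * exp (E z)"
    "\<And>z. z \<in> ball 0 1 - {0} \<Longrightarrow> deriv E z = (z * deriv F z / F z - 1) / z"
proof -
  define q where "q = (\<lambda>z. if z = 0 then 1 else F z / z)"
  have "q holomorphic_on ball 0 1"
    by (rule pole_theorem_open_0[OF assms(1), of 0]) (use assms in \<open>auto simp: q_def\<close>)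
  moreover have "q z \<noteq> 0" if "z \<in> ball 0 1" for z
    using nz that by (auto simp: q_def)
  ultimately obtain L where L: "L holomorphic_on ball 0 1" "\<And>z. z \<in> ball 0 1 \<Longrightarrow> exp (L z) = q z"
    using holomorphic_logarithm_exists[of "ball 0 1" q 0] by auto
  \<comment> \<open>\<open>exp (L 0) = q 0 = 1\<close>, so the shift by \<open>L 0\<close>
    normalises \<open>E 0 = 0\<close> without changing the exponential.\<close>
  define E where "E = (\<lambda>z. L z - L 0)"
  have hol: "E holomorphic_on ball 0 1"
    unfolding E_def by (intro holomorphic_intros L)
  have eq: "F z = z * exp (E z)" if "z \<in> ball 0 1" for z
    using L(2)[of z] L(2)[of 0] that assms(2) by (auto simp: E_def exp_diff q_def)
  have "deriv E z = (z * deriv F z / F z - 1) / z" if z: "z \<in> ball 0 1 - {0}" for z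
  proof -
    have "(E has_field_derivative deriv E z) (at z)"
      using holomorphic_derivI[OF hol] z by auto
    then have "((\<lambda>z. z * exp (E z)) has_field_derivative exp (E z) * (1 + z * deriv E z)) (at z)"
      by (auto intro!: derivative_eq_intros simp: algebra_simps)
    then have "(F has_field_derivative exp (E z) * (1 + z * deriv E z)) (at z)"
      by (rule has_field_derivative_transform_within_open[of _ _ _ "ball 0 1"])
         (use z eq in auto)
    then have "deriv F z = exp (E z) * (1 + z * deriv E z)" by (rule DERIV_imp_deriv)
    then show ?thesis using eq[of z] z by (auto simp: field_simps)
  qed
  with hol eq show ?thesis by (intro that[of E]) (auto simp: E_def)
qed

text \<open>The contour integral is replaced by a holomorphic primitive \<open>P\<close>, which
  makes \<open>h_psi\<close> comparable with the form \<open>z * exp (E z)\<close> of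
  \<open>h\<close>; its derivative is then
  \<open>exp P * (1 + z P') = exp P * \<psi>\<close>.\<close>

lemma h_psi_primitive:
  assumes "\<psi> holomorphic_on ball 0 1" "\<psi> 0 = 1"
  obtains P where "P 0 = 0" "P holomorphic_on ball 0 1"
    "\<And>z. z \<in> ball 0 1 - {0} \<Longrightarrow> deriv P z = (\<psi> z - 1) / z"
    "\<And>z. z \<in> ball 0 1 \<Longrightarrow> deriv (h_psi \<psi>) z = exp (P z) * \<psi> z"
proof -
  define k where "k = (\<lambda>z. if z = 0 then deriv (\<lambda>z. \<psi> z - 1) 0 else (\<psi> z - 1) / z)"
  have "(\<lambda>z. \<psi> z - 1) holomorphic_on ball 0 1" by (intro holomorphic_intros assms)
  then have "k holomorphic_on ball 0 1"
    by (rule pole_theorem_open_0[where a = 0]) (auto simp: assms(2) k_def)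
  then obtain P0 where "\<And>z. z \<in> ball 0 1 \<Longrightarrow> (P0 has_field_derivative k z) (at z within ball 0 1)"
    using holomorphic_convex_primitive'[of "ball 0 1" k] by auto
  then have P0: "(P0 has_field_derivative k z) (at z)" if "z \<in> ball 0 1" for z
    using that by (metis at_within_open open_ball)
  define P where "P = (\<lambda>z. P0 z - P0 0)"
  have P: "(P has_field_derivative k z) (at z)" if "z \<in> ball 0 1" for z
    unfolding P_def using P0[OF that] by (auto intro!: derivative_eq_intros)
  have hol: "P holomorphic_on ball 0 1"
    using P unfolding holomorphic_on_open[OF open_ball] by blast
  have h: "h_psi \<psi> z = z * exp (P z)" if z: "z \<in> ball 0 1" for z
  proof (cases "z = 0")
    case False
    have "closed_segment 0 z \<subseteq> ball 0 1"
      using z by (intro closed_segment_subset) auto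
    then have "(k has_contour_integral P z - P 0) (linepath 0 z)"
      using contour_integral_primitive[of "ball 0 1" P k "linepath 0 z"] P
      by (auto intro: has_field_derivative_at_within)
    then have "((\<lambda>x. k (linepath 0 z x) * (z - 0)) has_integral P z) {0..1}"
      by (simp add: has_contour_integral_linepath P_def)
    \<comment> \<open>The two integrands differ at most at \<open>x = 0\<close>, where
      \<open>k\<close> takes its limit value while division by zero yields 0.\<close>
    then have "((\<lambda>x. (\<psi> (linepath 0 z x) - 1) / linepath 0 z x * (z - 0)) has_integral P z) {0..1}"
      by (rule has_integral_spike_finite[of "{0}", rotated 2])
         (use False in \<open>auto simp: k_def linepath_def\<close>)
    then have "((\<lambda>t. (\<psi> t - 1) / t) has_contour_integral P z) (linepath 0 z)"
      by (simp only: has_contour_integral_linepath)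
    then show ?thesis by (simp add: h_psi_def contour_integral_unique)
  qed (simp add: h_psi_def)
  have "deriv (h_psi \<psi>) z = exp (P z) * \<psi> z" if z: "z \<in> ball 0 1" for z
  proof -
    have "((\<lambda>z. z * exp (P z)) has_field_derivative exp (P z) * (1 + z * k z)) (at z)"
      using P[OF z] by (auto intro!: derivative_eq_intros simp: algebra_simps)
    then have "(h_psi \<psi> has_field_derivative exp (P z) * (1 + z * k z)) (at z)"
      by (rule has_field_derivative_transform_within_open[of _ _ _ "ball 0 1"])
         (use z h in auto)
    then show ?thesis by (simp add: DERIV_imp_deriv k_def assms(2))
  qed
  moreover have "deriv P z = (\<psi> z - 1) / z" if "z \<in> ball 0 1 - {0}" for z
    using P[of z] that by (auto simp: k_def intro: DERIV_imp_deriv)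
  ultimately show ?thesis using hol by (intro that[of P]) (simp_all add: P_def)
qed

text \<open>\<open>h'\<close> is the product of \<open>exp E\<close> and \<open>z h' / h\<close>,
  and \<open>h_psi'\<close> that of \<open>exp P\<close> and \<open>\<psi>\<close>. Each factor of
  the first is majorised by the matching factor of the second at \<open>R\<close>. Allowing any
  \<open>R \<ge> cmod z\<close> gives one bound for a whole disk.\<close>

lemma S_star_deriv_bound:
  assumes \<psi>: "admissible_psi \<psi>" and h: "S_star \<psi> h" and R: "R < 1" "cmod z \<le> R"
  shows "cmod (deriv h z - 1) \<le> cmod (deriv (h_psi \<psi>) (of_real R)) - 1"
proof -
  have hh: "h holomorphic_on ball 0 1" "h 0 = 0" "deriv h 0 = 1"
    "\<And>z. z \<in> ball 0 1 - {0} \<Longrightarrow> h z \<noteq> 0"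
    and sub: "subordinate (\<lambda>z. if z = 0 then 1 else z * deriv h z / h z) \<psi>"
    using h by (auto simp: S_star_def)
  have "\<psi> holomorphic_on ball 0 1" "\<psi> 0 = 1"
    using \<psi> by (auto simp: admissible_psi_def)
  then obtain P where P: "P 0 = 0" "P holomorphic_on ball 0 1"
    "\<And>z. z \<in> ball 0 1 - {0} \<Longrightarrow> deriv P z = (\<psi> z - 1) / z"
    "\<And>z. z \<in> ball 0 1 \<Longrightarrow> deriv (h_psi \<psi>) z = exp (P z) * \<psi> z"
    by (rule h_psi_primitive) blast
  obtain E where E: "E 0 = 0" "E holomorphic_on ball 0 1"
    "\<And>z. z \<in> ball 0 1 \<Longrightarrow> h z = z * exp (E z)"
    "\<And>z. z \<in> ball 0 1 - {0} \<Longrightarrow> deriv E z = (z * deriv h z / h z - 1) / z"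
    using holomorphic_log_quotient[OF hh] by blast
  obtain \<omega> where \<omega>: "\<omega> holomorphic_on ball 0 1" "\<omega> ` ball 0 1 \<subseteq> ball 0 1" "\<omega> 0 = 0"
    "\<And>z. z \<in> ball 0 1 \<Longrightarrow> (if z = 0 then 1 else z * deriv h z / h z) = \<psi> (\<omega> z)"
    using sub unfolding subordinate_def by blast
  have Schwarz: "cmod (\<omega> u) \<le> cmod u" if "cmod u < 1" for u
    by (rule Schwarz_Lemma(1)) (use \<omega>(1-3) that in \<open>auto simp: image_subset_iff\<close>)
  have q: "cmod ((if u = 0 then 1 else u * deriv h u / h u) - 1) \<le> Re (\<psi> (of_real r)) - 1"
    if "cmod u \<le> r" "r < 1" for u r
    using admissible_psi_majorant[OF \<psi>, of "\<omega> u" r] Schwarz[of u] \<omega>(4)[of u] that by auto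
  have "R \<ge> 0" using R norm_ge_zero order_trans by blast
  have in_disk: "of_real x * u \<in> ball 0 1" if "x \<in> {0..1}" "cmod u \<le> R" for x :: real and u :: complex
  proof -
    have "x * cmod u \<le> 1 * R" using that by (intro mult_mono) auto
    then show ?thesis using R(1) that by (auto simp: norm_mult)
  qed
  \<comment> \<open>\<open>E\<close> along the segment to \<open>z\<close> is compared with
    \<open>Re P\<close> along the segment to \<open>R\<close>, both parametrised by the same
    \<open>x\<close>. The speeds are \<open>cmod ((z h' / h)(x z) - 1) / x\<close> and
    \<open>?B x\<close>, which \<open>q\<close> compares at radius \<open>x * R\<close>.\<close>
  have cmp: "cmod (E z) \<le> Re (P (of_real R))"
  proof -
    let ?B = "\<lambda>x. (Re (\<psi> (of_real (x * R))) - 1) / x"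
    have E': "(E has_field_derivative deriv E (of_real x * z)) (at (of_real x * z))"
      and P': "(P has_field_derivative deriv P (of_real x * of_real R)) (at (of_real x * of_real R))"
      if "x \<in> {0..1}" for x :: real
      using in_disk[OF that] R(2) \<open>R \<ge> 0\<close>
      by (auto intro!: holomorphic_derivI[OF E(2)] holomorphic_derivI[OF P(2)])
    have dE: "((\<lambda>x. E (of_real x * z)) has_vector_derivative z * deriv E (of_real x * z)) (at x)"
      and dP: "((\<lambda>x. P (of_real x * of_real R)) has_vector_derivative
        of_real R * deriv P (of_real x * of_real R)) (at x)" if "x \<in> {0..1}" for x :: real
    proof -
      have "((\<lambda>x. E (x * z)) has_field_derivative deriv E (of_real x * z) * z) (at (of_real x))"
        by (rule DERIV_chain2[where f = E and g = "\<lambda>x. x * z", OF E'[OF that]]) (auto intro!: derivative_eq_intros)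
      then show "((\<lambda>x. E (of_real x * z)) has_vector_derivative z * deriv E (of_real x * z)) (at x)"
        by (subst mult.commute) (rule has_vector_derivative_real_field)
      have "((\<lambda>x. P (x * of_real R)) has_field_derivative
          deriv P (of_real x * of_real R) * of_real R) (at (of_real x))"
        by (rule DERIV_chain2[where f = P and g = "\<lambda>x. x * of_real R", OF P'[OF that]]) (auto intro!: derivative_eq_intros)
      then show "((\<lambda>x. P (of_real x * of_real R)) has_vector_derivative
          of_real R * deriv P (of_real x * of_real R)) (at x)"
        by (subst mult.commute) (rule has_vector_derivative_real_field)
    qed
    have "norm (E (of_real 1 * z) - E (of_real 0 * z))
      \<le> Re (P (of_real 1 * of_real R)) - Re (P (of_real 0 * of_real R))"
    proof (rule differentiable_bound_general[where f' = "\<lambda>x. z * deriv E (of_real x * z)" and \<phi>' = ?B])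
      show "continuous_on {0..1} (\<lambda>x. E (of_real x * z))"
        using dE[THEN has_vector_derivative_continuous]
        by (intro continuous_at_imp_continuous_on) blast
      show "continuous_on {0..1} (\<lambda>x. Re (P (of_real x * of_real R)))"
        using dP[THEN has_vector_derivative_continuous]
        by (intro continuous_at_imp_continuous_on ballI isCont_Re) blast
      fix x :: real assume x: "0 < x" "x < 1"
      then have x': "x \<in> {0..1}" by simp
      show "((\<lambda>x. E (of_real x * z)) has_vector_derivative z * deriv E (of_real x * z)) (at x)"
        by (rule dE[OF x'])
      have "of_real R * deriv P (of_real x * of_real R) = (\<psi> (of_real (x * R)) - 1) / of_real x"
        using P(3)[of "of_real x * of_real R"] in_disk[OF x', of "of_real R"] \<open>R \<ge> 0\<close> \<open>\<psi> 0 = 1\<close> x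
        by (cases "R = 0") auto
      with dP[OF x'] have "((\<lambda>x. P (of_real x * of_real R)) has_vector_derivative
          (\<psi> (of_real (x * R)) - 1) / of_real x) (at x)" by simp
      from bounded_linear.has_vector_derivative[OF bounded_linear_Re this]
      show "((\<lambda>x. Re (P (of_real x * of_real R))) has_vector_derivative ?B x) (at x)" by simp
      have le: "cmod (of_real x * z) \<le> x * R" "x * R < 1"
        using x R \<open>R \<ge> 0\<close> in_disk[OF x', of "of_real R"] by (auto simp: norm_mult)
      from q[OF this] have q': "0 \<le> ?B x"
        "z \<noteq> 0 \<Longrightarrow> cmod ((of_real x * z) * deriv h (of_real x * z) / h (of_real x * z) - 1) / x \<le> ?B x"
        using x order_trans[OF norm_ge_zero] by (fastforce intro: divide_right_mono)+
      show "norm (z * deriv E (of_real x * z)) \<le> ?B x"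
      proof (cases "z = 0")
        case False
        then have "z * deriv E (of_real x * z)
          = ((of_real x * z) * deriv h (of_real x * z) / h (of_real x * z) - 1) / of_real x"
          using E(4)[of "of_real x * z"] x in_disk[OF x' R(2)] by simp
        then have "norm (z * deriv E (of_real x * z))
          = cmod ((of_real x * z) * deriv h (of_real x * z) / h (of_real x * z) - 1) / x"
          using x by (simp only: norm_divide norm_of_real abs_of_pos)
        then show ?thesis using q'(2)[OF False] by (simp only:)
      qed (use q' in simp)
    qed simp
    then show ?thesis by (simp add: E(1) P(1))
  qed
  let ?p = "if z = 0 then 1 else z * deriv h z / h z" and ?s = "Re (\<psi> (of_real R))"
  have "deriv h z = exp (E z) * ?p"
    using hh(3) E(1) E(3)[of z] hh(4)[of z] R by auto
  \<comment> \<open>This splitting leaves only quantities with known majorants; at the majorants it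
    adds up to \<open>exp (Re P) * ?s - 1\<close>.\<close>
  then have "deriv h z - 1 = (exp (E z) - 1) * ?p + (?p - 1)"
    by (simp add: algebra_simps)
  then have "cmod (deriv h z - 1) \<le> cmod (exp (E z) - 1) * cmod ?p + cmod (?p - 1)"
    by (metis norm_mult norm_triangle_ineq)
  also have "\<dots> \<le> (exp (Re (P (of_real R))) - 1) * ?s + (?s - 1)"
  proof (intro add_mono mult_mono)
    show "cmod (exp (E z) - 1) \<le> exp (Re (P (of_real R))) - 1"
      using norm_exp_minus_one_le[of "E z"] cmp exp_le_cancel_iff[of "cmod (E z)" "Re (P (of_real R))"] by linarith
    show "cmod (?p - 1) \<le> ?s - 1" using q[OF R(2,1)] .
    then show "cmod ?p \<le> ?s" using norm_triangle_sub[of ?p 1] by simp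
    show "0 \<le> exp (Re (P (of_real R))) - 1" using order_trans[OF norm_ge_zero cmp] by simp
  qed simp
  also have "\<dots> = exp (Re (P (of_real R))) * ?s - 1" by (simp add: algebra_simps)
  also have "\<dots> \<le> cmod (deriv (h_psi \<psi>) (of_real R)) - 1"
    using P(4)[of "of_real R"] R \<open>R \<ge> 0\<close> complex_Re_le_cmod[of "\<psi> (of_real R)"]
    by (simp add: norm_mult norm_exp_eq_Re)
  finally show ?thesis .
qed

section \<open>The dilatation\<close>

text \<open>A positive Jacobian makes \<open>g' / h'\<close> a self-map of the disk; it vanishes at
  0 because \<open>g'(0) = 0\<close>, so the Schwarz lemma applies.\<close>

lemma SH0_dilatation:
  assumes "SH0 f h g" "cmod z < 1"
  shows "cmod (deriv g z) \<le> cmod z * cmod (deriv h z)"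
proof -
  have hol: "h holomorphic_on ball 0 1" "g holomorphic_on ball 0 1"
    and f: "\<And>z. z \<in> ball 0 1 \<Longrightarrow> f z = h z + cnj (g z)"
    and sp: "sense_preserving_on f (ball 0 1)"
    and g0: "deriv g 0 = 0"
    using assms by (auto simp: SH0_def)
  have less: "cmod (deriv g u) < cmod (deriv h u)" if u: "cmod u < 1" for u
  proof -
    obtain L where L: "(f has_derivative L) (at u)" "Im (cnj (L 1) * L \<i>) > 0"
      using sp u unfolding sense_preserving_on_def by (meson mem_ball_0)
    have "(h has_field_derivative deriv h u) (at u)" "(g has_field_derivative deriv g u) (at u)"
      using hol u by (auto intro: holomorphic_derivI)
    then have "((\<lambda>z. h z + cnj (g z)) has_derivative (\<lambda>v. deriv h u * v + cnj (deriv g u * v))) (at u)"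
      unfolding has_field_derivative_def
      by (intro has_derivative_add bounded_linear.has_derivative[OF bounded_linear_cnj])
    then have "(f has_derivative (\<lambda>v. deriv h u * v + cnj (deriv g u * v))) (at u)"
      by (rule has_derivative_transform_within_open[of _ _ _ _ "ball 0 1"]) (use f u in auto)
    \<comment> \<open>By uniqueness of the derivative, the determinant of \<open>L\<close> is
      \<open>|h'|^2 - |g'|^2\<close>.\<close>
    then have "L = (\<lambda>v. deriv h u * v + cnj (deriv g u * v))"
      using L(1) has_derivative_unique by blast
    with L(2) have "(cmod (deriv g u))\<^sup>2 < (cmod (deriv h u))\<^sup>2"
      unfolding cmod_power2 by (simp add: power2_eq_square algebra_simps)
    then show ?thesis by (rule power2_less_imp_less) simp
  qed
  have nz: "deriv h u \<noteq> 0" if "cmod u < 1" for u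
    using less[OF that] by auto
  have "cmod (deriv g z / deriv h z) \<le> cmod z"
  proof (rule Schwarz_Lemma(1)[where f = "\<lambda>z. deriv g z / deriv h z"])
    show "(\<lambda>z. deriv g z / deriv h z) holomorphic_on ball 0 1"
      by (intro holomorphic_intros hol) (use nz in auto)
    show "cmod (deriv g u / deriv h u) < 1" if "cmod u < 1" for u
      using less[OF that] by (simp add: norm_divide divide_less_eq)
  qed (use g0 assms in auto)
  then show ?thesis using nz[OF assms(2)] by (simp add: norm_divide divide_le_eq)
qed

section \<open>Geometry of harmonic maps close to the identity\<close>

text \<open>As \<open>2/3 < 1 / sqrt 2\<close>, the disk of radius 2/3 about 1 lies in the sector of
  arguments below \<open>pi/4\<close> in absolute value. The proof uses \<open>2 Re (a * cnj b) = |a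
  + b - 1|^2 + 1 - |a - 1|^2 - |b - 1|^2 \<ge> 1 - 8/9\<close>.\<close>

lemma Re_mult_cnj_pos:
  assumes "cmod (a - 1) \<le> 2/3" "cmod (b - 1) \<le> 2/3"
  shows "Re (a * cnj b) > 0"
proof -
  have "(cmod (a - 1))\<^sup>2 \<le> (2/3)\<^sup>2" "(cmod (b - 1))\<^sup>2 \<le> (2/3)\<^sup>2"
    using assms by (auto intro: power_mono)
  then have "(Re a - 1)\<^sup>2 + (Im a)\<^sup>2 \<le> 4/9" "(Re b - 1)\<^sup>2 + (Im b)\<^sup>2 \<le> 4/9"
    by (simp_all add: cmod_power2 power_divide)
  then have "0 < (Re a + Re b - 1)\<^sup>2 + (Im a + Im b)\<^sup>2 + 1
      - ((Re a - 1)\<^sup>2 + (Im a)\<^sup>2) - ((Re b - 1)\<^sup>2 + (Im b)\<^sup>2)"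
    using zero_le_power2[of "Re a + Re b - 1"] zero_le_power2[of "Im a + Im b"] by linarith
  also have "\<dots> = 2 * Re (a * cnj b)"
    by (simp add: power2_eq_square algebra_simps)
  finally show ?thesis by simp
qed

text \<open>This is all the geometric argument needs: \<open>1/4 + 5/12 = 2/3\<close> is the radius
  allowed in \<open>Re_mult_cnj_pos\<close>.\<close>

locale close_to_identity =
  fixes f h g :: "complex \<Rightarrow> complex" and \<rho> :: real
  assumes hol: "h holomorphic_on ball 0 \<rho>" "g holomorphic_on ball 0 \<rho>"
    and f_eq: "z \<in> ball 0 \<rho> \<Longrightarrow> f z = h z + cnj (g z)"
    and h'_bound: "z \<in> ball 0 \<rho> \<Longrightarrow> cmod (deriv h z - 1) \<le> 1/4"
    and g'_bound: "z \<in> ball 0 \<rho> \<Longrightarrow> cmod (deriv g z) \<le> 5/12"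
    and f_0: "f 0 = 0"
begin

lemma has_deriv:
  assumes "z \<in> ball 0 \<rho>"
  shows "(h has_field_derivative deriv h z) (at z within A)"
    "(g has_field_derivative deriv g z) (at z within A)"
  using hol assms by (auto intro: holomorphic_derivI)

text \<open>The mean value inequality on the convex ball applies to \<open>h z - z\<close> with
  constant 1/4 and to \<open>g\<close> with 5/12.\<close>

lemma quotient_near_1:
  assumes "z \<in> ball 0 \<rho>" "w \<in> ball 0 \<rho>" "z \<noteq> w"
  shows "cmod ((f z - f w) / (z - w) - 1) \<le> 2/3"
proof -
  have "norm ((h z - z) - (h w - w)) \<le> 1/4 * norm (z - w)"
    by (rule field_differentiable_bound[of "ball 0 \<rho>" _ "\<lambda>u. deriv h u - 1"])
       (use assms h'_bound in \<open>auto intro!: derivative_eq_intros has_deriv\<close>)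
  moreover have "norm (g z - g w) \<le> 5/12 * norm (z - w)"
    by (rule field_differentiable_bound[of "ball 0 \<rho>" _ "deriv g"])
       (use assms g'_bound in \<open>auto intro!: has_deriv\<close>)
  moreover have "f z - f w - (z - w) = (h z - z - (h w - w)) + cnj (g z - g w)"
    using assms by (simp add: f_eq)
  ultimately have "cmod (f z - f w - (z - w)) \<le> 2/3 * cmod (z - w)"
    using norm_triangle_ineq[of "h z - z - (h w - w)" "cnj (g z - g w)"]
    by (simp only: complex_mod_cnj)
  then have "cmod ((f z - f w - (z - w)) / (z - w)) \<le> 2/3"
    using assms(3) by (simp add: norm_divide divide_le_eq)
  then show ?thesis using assms(3) by (simp add: diff_divide_distrib)
qed

lemma inj: "inj_on f (ball 0 \<rho>)"
proof (rule inj_onI)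
  fix z w assume "z \<in> ball 0 \<rho>" "w \<in> ball 0 \<rho>" "f z = f w"
  \<comment> \<open>Equal values would make the quotient 0, at distance 1 from 1.\<close>
  then show "z = w" using quotient_near_1[of z w] by force
qed

lemma continuous: "continuous_on (ball 0 \<rho>) f"
  using holomorphic_on_imp_continuous_on hol
  by (subst continuous_on_cong[OF refl f_eq]) (auto intro!: continuous_intros)

text \<open>Dividing by \<open>v t = s * cis t\<close> leaves a factor \<open>b\<close> in the right
  half-plane, so \<open>t + Im (Ln (b t))\<close> is a smooth argument with the principal logarithm.
  This serves both the circles about 0 and the arcs about \<open>\<zeta>\<close>.\<close>

lemma arg_branch_arc:
  assumes \<zeta>: "\<zeta> \<in> ball 0 \<rho>" and s: "s > 0"
    and I: "\<And>t. t \<in> I \<Longrightarrow> \<zeta> + of_real s * cis t \<in> ball 0 \<rho>"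
  shows "\<exists>\<alpha>. arg_branch I (\<lambda>t. f (\<zeta> + of_real s * cis t) - f \<zeta>) \<alpha> \<and>
    (\<forall>t\<in>I. \<exists>d>0. (\<alpha> has_real_derivative d) (at t))"
proof -
  define \<gamma> where "\<gamma> = (\<lambda>t. f (\<zeta> + of_real s * cis t) - f \<zeta>)"
  define v where "v = (\<lambda>t. of_real s * cis t)"
  define b where "b = (\<lambda>t. \<gamma> t / v t)"
  define \<alpha> where "\<alpha> = (\<lambda>t. t + Im (Ln (b t)))"
  have v0: "v t \<noteq> 0" for t using s by (simp add: v_def)
  have b1: "cmod (b t - 1) \<le> 2/3" if "t \<in> I" for t
    using quotient_near_1[OF I[OF that] \<zeta>] v0[of t] by (simp add: b_def \<gamma>_def v_def)
  have b_pos: "Re (b t) > 0" if "t \<in> I" for t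
    using Re_mult_cnj_pos[OF b1[OF that], of 1] by simp
  have b0: "b t \<noteq> 0" if "t \<in> I" for t using b_pos[OF that] by auto
  have \<gamma>0: "\<gamma> t \<noteq> 0" if "t \<in> I" for t using b0[OF that] by (auto simp: b_def)
  have polar: "\<gamma> t = of_real (cmod (\<gamma> t)) * cis (\<alpha> t)" if "t \<in> I" for t
  proof -
    have "b t = of_real (cmod (b t)) * cis (Im (Ln (b t)))"
      using exp_Ln[OF b0[OF that]] by (metis exp_eq_polar norm_exp_eq_Re)
    moreover have "\<gamma> t = of_real s * cis t * b t" using v0 by (simp add: b_def v_def)
    moreover have "cmod (\<gamma> t) = s * cmod (b t)" using s calculation(2) by (simp add: norm_mult)
    ultimately show ?thesis
      by (metis (no_types, lifting) \<alpha>_def cis_mult mult.assoc mult.left_commute of_real_mult)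
  qed
  have deriv: "\<exists>d>0. (\<alpha> has_real_derivative d) (at t)" if t: "t \<in> I" for t
  proof -
    define z where "z = \<zeta> + v t"
    \<comment> \<open>\<open>\<i> * A\<close> is the derivative of \<open>\<gamma>\<close>; the
      minus sign arises because conjugation turns \<open>\<i>\<close> into
      \<open>-\<i>\<close>.\<close>
    define A where "A = v t * deriv h z - cnj (v t * deriv g z)"
    have z: "z \<in> ball 0 \<rho>" using I[OF t] by (simp add: z_def v_def)
    have dcis: "(v has_vector_derivative \<i> * v t) (at t)"
      unfolding v_def cis_conv_exp
      by (rule has_vector_derivative_real_field[where f = "\<lambda>x. of_real s * exp (\<i> * x)"])
         (auto intro!: derivative_eq_intros)
    then have dz: "((\<lambda>t. \<zeta> + v t) has_vector_derivative \<i> * v t) (at t)"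
      by (auto intro!: derivative_eq_intros)
    have cv: "isCont (\<lambda>t. \<zeta> + v t) t"
      using dz by (rule has_vector_derivative_continuous)
    have "((\<lambda>t. h (\<zeta> + v t)) has_vector_derivative \<i> * v t * deriv h z) (at t)"
      "((\<lambda>t. g (\<zeta> + v t)) has_vector_derivative \<i> * v t * deriv g z) (at t)"
      using field_vector_diff_chain_at[OF dz] has_deriv[OF z] by (auto simp: o_def z_def)
    then have "((\<lambda>t. h (\<zeta> + v t) + cnj (g (\<zeta> + v t)) - f \<zeta>) has_vector_derivative
        \<i> * v t * deriv h z + cnj (\<i> * v t * deriv g z) - 0) (at t)"
      by (intro has_vector_derivative_add has_vector_derivative_diff
          bounded_linear.has_vector_derivative[OF bounded_linear_cnj] has_vector_derivative_const)
    then have "((\<lambda>t. h (\<zeta> + v t) + cnj (g (\<zeta> + v t)) - f \<zeta>) has_vector_derivative \<i> * A) (at t)"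
      by (simp add: A_def algebra_simps)
    moreover have "open ((\<lambda>t. \<zeta> + v t) -` ball 0 \<rho>)"
      by (intro open_vimage) (auto simp: v_def intro!: continuous_intros)
    ultimately have d\<gamma>: "(\<gamma> has_vector_derivative \<i> * A) (at t)"
      by (rule has_vector_derivative_transform_within_open) (use z f_eq in \<open>auto simp: \<gamma>_def v_def z_def\<close>)
    have "(b has_vector_derivative
        \<gamma> t * (\<i> * v t * - (inverse (v t) * inverse (v t))) + \<i> * A * inverse (v t)) (at t)"
      unfolding b_def divide_inverse
      using d\<gamma> field_vector_diff_chain_at[OF dcis DERIV_inverse'[OF DERIV_ident v0]]
      by (intro has_vector_derivative_mult) (auto simp: o_def mult.assoc)
    also have "\<gamma> t * (\<i> * v t * - (inverse (v t) * inverse (v t))) + \<i> * A * inverse (v t)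
        = (\<i> * A / \<gamma> t - \<i>) * b t"
      using v0[of t] \<gamma>0[OF t] by (simp add: b_def field_simps)
    finally have db: "(b has_vector_derivative (\<i> * A / \<gamma> t - \<i>) * b t) (at t)" .
    have "b t \<notin> \<real>\<^sub>\<le>\<^sub>0" using b_pos[OF t] by (auto simp: complex_nonpos_Reals_iff)
    from field_vector_diff_chain_at[OF db has_field_derivative_Ln[OF this]]
    have "((\<lambda>t. Ln (b t)) has_vector_derivative \<i> * A / \<gamma> t - \<i>) (at t)"
      unfolding o_def mult.assoc right_inverse[OF b0[OF t]] by simp
    from bounded_linear.has_vector_derivative[OF bounded_linear_Im this]
    have "(\<alpha> has_real_derivative 1 + Im (\<i> * A / \<gamma> t - \<i>)) (at t)"
      unfolding \<alpha>_def has_real_derivative_iff_has_vector_derivative[symmetric]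
      by (intro DERIV_add DERIV_ident)
    \<comment> \<open>The 1 from the summand \<open>t\<close> of \<open>\<alpha>\<close> cancels the
      imaginary part of \<open>-\<i>\<close>, the contribution of \<open>1 / v\<close>.\<close>
    moreover have "1 + Im (\<i> * A / \<gamma> t - \<i>) = Re (A / \<gamma> t)"
    proof -
      have "\<i> * A / \<gamma> t = \<i> * (A / \<gamma> t)" by simp
      then show ?thesis by (metis Im_i_times add.commute diff_add_cancel imaginary_unit.sel(2) minus_complex.sel(2))
    qed
    moreover have "Re (A / \<gamma> t) > 0"
    proof -
      have "A / v t - 1 = (deriv h z - 1) - cnj (v t * deriv g z) / v t"
        using v0[of t] by (simp add: A_def field_simps)
      also have "cmod \<dots> \<le> cmod (deriv h z - 1) + cmod (cnj (v t * deriv g z) / v t)"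
        by (rule norm_triangle_ineq4)
      also have "cmod (cnj (v t * deriv g z) / v t) = cmod (deriv g z)"
        using v0[of t] by (simp only: norm_divide complex_mod_cnj norm_mult) simp
      finally have "cmod (A / v t - 1) \<le> 2/3"
        using h'_bound[OF z] g'_bound[OF z] by simp
      then have "Re (A / v t * cnj (b t)) > 0" by (intro Re_mult_cnj_pos b1 t)
      \<comment> \<open>Since \<open>\<gamma> = v * b\<close>, the quotient is
        \<open>(A / v) / b\<close>, and both \<open>A / v\<close> and \<open>b\<close> are within
        2/3 of 1.\<close>
      moreover have "A / \<gamma> t = (A / v t * cnj (b t)) / of_real ((cmod (b t))\<^sup>2)"
        using v0[of t] \<gamma>0[OF t] b0[OF t] unfolding complex_norm_square
        by (simp add: b_def field_simps)
      ultimately show ?thesis using b0[OF t] by (simp only: Re_divide_of_real) simp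
    qed
    ultimately show ?thesis by metis
  qed
  have "continuous_on I \<alpha>"
    using deriv by (intro continuous_at_imp_continuous_on) (blast intro: DERIV_isCont)
  with deriv polar \<gamma>0 show ?thesis unfolding arg_branch_def \<gamma>_def by blast
qed

text \<open>\<open>A * (z - z0) = \<epsilon> * B * z0\<close> with \<open>A\<close> and
  \<open>B\<close> both within 2/3 of 1, so \<open>z - z0\<close> makes an acute angle with
  \<open>z0\<close> and leads outwards.\<close>

lemma norm_less_on_ray:
  assumes "z \<in> ball 0 \<rho>" "z0 \<in> ball 0 \<rho>" "z0 \<noteq> 0" "\<epsilon> > 0" "f z = (1 + of_real \<epsilon>) * f z0"
  shows "cmod z0 < cmod z"
proof -
  define B where "B = f z0 / z0"
  define A where "A = (f z - f z0) / (z - z0)"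
  have "0 < \<rho>" using assms(2) by (auto intro: le_less_trans[OF norm_ge_zero])
  then have B1: "cmod (B - 1) \<le> 2/3"
    using quotient_near_1[of z0 0] assms by (simp add: f_0 B_def)
  then have "B \<noteq> 0" by auto
  then have ne: "z \<noteq> z0" using assms by (auto simp: B_def algebra_simps)
  then have A1: "cmod (A - 1) \<le> 2/3"
    using quotient_near_1[of z z0] assms by (simp add: A_def)
  then have "A \<noteq> 0" by auto
  have "A * (z - z0) = of_real \<epsilon> * (B * z0)"
    using ne assms(3) by (simp add: A_def B_def assms(5) distrib_right)
  then have "z - z0 = of_real \<epsilon> * (B * z0) / A"
    using \<open>A \<noteq> 0\<close> by (simp add: eq_divide_eq mult.commute)
  then have "(z - z0) * cnj z0 = of_real \<epsilon> * (B * z0) / A * cnj z0" by simp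
  also have "\<dots> = of_real \<epsilon> * (B * cnj A) * (z0 * cnj z0) / (A * cnj A)"
    using \<open>A \<noteq> 0\<close> by (simp add: field_simps)
  also have "\<dots> = of_real (\<epsilon> * (cmod z0)\<^sup>2 / (cmod A)\<^sup>2) * (B * cnj A)"
    by (simp add: complex_norm_square[symmetric] mult_ac)
  finally have "Re ((z - z0) * cnj z0) = \<epsilon> * (cmod z0)\<^sup>2 / (cmod A)\<^sup>2 * Re (B * cnj A)"
    by simp
  also have "\<dots> > 0"
    using Re_mult_cnj_pos[OF B1 A1] assms \<open>A \<noteq> 0\<close> by simp
  finally have "(cmod z0)\<^sup>2 < Re (z * cnj z0)"
    unfolding cmod_power2 by (simp add: power2_eq_square algebra_simps)
  also have "\<dots> \<le> cmod z * cmod z0" by (metis complex_Re_le_cmod complex_mod_cnj norm_mult)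
  finally show ?thesis using assms(3) by (simp add: power2_eq_square)
qed

text \<open>The domain is the image of the open disk. Compactness and injectivity identify its
  frontier; \<open>norm_less_on_ray\<close> keeps radial segments inside.\<close>

lemma starlike_domain:
  assumes "0 < r" "r < \<rho>"
  shows "\<exists>D. open D \<and> connected D \<and> bounded D \<and> frontier D = f ` sphere 0 r \<and> starlike_wrt 0 D"
proof (intro exI conjI)
  let ?D = "f ` ball 0 r"
  have sub: "cball 0 r \<subseteq> ball (0::complex) \<rho>" "ball 0 r \<subseteq> ball (0::complex) \<rho>" using assms by auto
  have cont: "continuous_on (cball 0 r) f" "continuous_on (ball 0 r) f"
    using continuous_on_subset[OF continuous] sub by blast+
  have inj_r: "inj_on f (cball 0 r)" using inj_on_subset[OF inj] sub by blast
  show op: "open ?D"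
    by (rule invariance_of_domain) (use cont inj_on_subset[OF inj] sub in auto)
  show "connected ?D" by (intro connected_continuous_image cont) simp
  have comp: "compact (f ` cball 0 r)" by (intro compact_continuous_image cont) simp
  then show "bounded ?D" by (rule bounded_subset[OF compact_imp_bounded]) auto
  have "closure ?D = f ` cball 0 r"
  proof
    show "closure ?D \<subseteq> f ` cball 0 r"
      by (rule closure_minimal) (use comp compact_imp_closed in auto)
    show "f ` cball 0 r \<subseteq> closure ?D"
      using continuous_image_closure_subset[of "cball 0 r" f "ball 0 r"] cont assms by auto
  qed
  then have "frontier ?D = f ` cball 0 r - f ` ball 0 r"
    using op by (simp add: frontier_def interior_open)
  also have "\<dots> = f ` (cball 0 r - ball 0 r)"
    using inj_on_image_set_diff[OF inj_r, of "cball 0 r" "ball 0 r"] by auto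
  also have "cball 0 r - ball 0 r = sphere (0::complex) r" by auto
  finally show fr: "frontier ?D = f ` sphere 0 r" .
  show "starlike_wrt 0 ?D"
    unfolding starlike_wrt_def
  proof (intro conjI ballI)
    show 0: "0 \<in> ?D" using f_0 assms by (auto intro!: image_eqI[of _ _ 0])
    fix w assume w: "w \<in> ?D"
    show "closed_segment 0 w \<subseteq> ?D"
    proof (rule ccontr)
      assume "\<not> closed_segment 0 w \<subseteq> ?D"
      \<comment> \<open>A segment that starts in the image at 0 and leaves it crosses the frontier,
        at \<open>f z0\<close> with \<open>cmod z0 = r\<close>.\<close>
      then have "closed_segment 0 w \<inter> frontier ?D \<noteq> {}"
        using 0 by (intro connected_Int_frontier) auto
      then obtain x where x: "x \<in> closed_segment 0 w" "x \<in> frontier ?D" by blast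
      then obtain z0 where z0: "x = f z0" "cmod z0 = r"
        unfolding fr by auto
      obtain z where z: "w = f z" "cmod z < r" using w by auto
      obtain \<tau> where \<tau>: "0 \<le> \<tau>" "\<tau> \<le> 1" "x = of_real \<tau> * w"
        using x(1) by (auto simp: in_segment scaleR_conv_of_real)
      have "x \<notin> ?D" using x(2) op by (simp add: frontier_def interior_open)
      then have "\<tau> \<noteq> 0" "\<tau> \<noteq> 1" using \<tau> 0 w by auto
      \<comment> \<open>The end \<open>w = x / \<tau>\<close> lies farther out on the same ray, with
        \<open>\<epsilon> = 1 / \<tau> - 1\<close>; its preimage would have modulus above
        \<open>r\<close>.\<close>
      then have "1 / \<tau> - 1 > 0" "f z = (1 + of_real (1 / \<tau> - 1)) * f z0"
        using \<tau> z z0 by (auto simp: field_simps)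
      then have "cmod z0 < cmod z"
        using z z0 assms norm_less_on_ray[of z z0 "1 / \<tau> - 1"] by auto
      then show False using z z0 by simp
    qed
  qed
qed

lemma uniformly_starlike: "uniformly_starlike f \<rho>"
  unfolding uniformly_starlike_def fully_starlike_def
proof (intro conjI allI impI)
  fix r assume r: "0 < r \<and> r < \<rho>"
  show "inj_on f (sphere 0 r)" using r by (intro inj_on_subset[OF inj]) auto
  show "\<exists>D. open D \<and> connected D \<and> bounded D \<and> frontier D = f ` sphere 0 r \<and> starlike_wrt 0 D"
    using r starlike_domain by blast
  show "\<exists>\<alpha>. arg_branch UNIV (\<lambda>\<theta>. f (of_real r * cis \<theta>)) \<alpha> \<and>
      (\<forall>\<theta>. \<exists>d>0. (\<alpha> has_real_derivative d) (at \<theta>))"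
    using arg_branch_arc[of 0 r UNIV] r by (auto simp: f_0 norm_mult)
next
  fix \<zeta> s a b
  assume *: "\<zeta> \<in> ball 0 \<rho> \<and> 0 < s \<and> a < b \<and> b \<le> a + 2 * pi \<and>
        (\<forall>t\<in>{a..b}. \<zeta> + of_real s * cis t \<in> ball 0 \<rho>)"
  then obtain \<alpha> where \<alpha>: "arg_branch {a..b} (\<lambda>t. f (\<zeta> + of_real s * cis t) - f \<zeta>) \<alpha>"
    "\<forall>t\<in>{a..b}. \<exists>d>0. (\<alpha> has_real_derivative d) (at t)"
    using arg_branch_arc[of \<zeta> s "{a..b}"] by blast
  have "mono_on {a..b} \<alpha>"
  proof (rule mono_onI)
    fix x y assume xy: "x \<in> {a..b}" "y \<in> {a..b}" "x \<le> y"
    show "\<alpha> x \<le> \<alpha> y"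
    proof (rule DERIV_nonneg_imp_nondecreasing[OF xy(3)])
      fix t assume "x \<le> t" "t \<le> y"
      then have "t \<in> {a..b}" using xy by auto
      then show "\<exists>d. (\<alpha> has_real_derivative d) (at t) \<and> 0 \<le> d"
        using \<alpha>(2) less_imp_le by blast
    qed
  qed
  with \<alpha> show "\<exists>\<alpha>. arg_branch {a..b} (\<lambda>t. f (\<zeta> + of_real s * cis t) - f \<zeta>) \<alpha> \<and> mono_on {a..b} \<alpha>"
    by blast
qed

end

section \<open>The derivative bounds on the disk of radius
  \<open>min (1/3) r\<^sub>\<psi>\<close>\<close>

theorem theorem9:
  fixes f h g \<psi> :: "complex \<Rightarrow> complex" and r\<^sub>\<psi> :: real
  assumes "admissible_psi \<psi>"
    and "SH0 f h g"
    and "S_star \<psi> h"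
    and "\<exists>\<phi>. Bs \<phi> \<and> (\<forall>z\<in>unit_disk. g z = \<phi> z * h z)"
    and "0 < r\<^sub>\<psi>" and "r\<^sub>\<psi> < 1"
    and "deriv (h_psi \<psi>) (of_real r\<^sub>\<psi>) - 5/4 = 0"
    and "\<And>r. 0 < r \<Longrightarrow> r < 1 \<Longrightarrow> deriv (h_psi \<psi>) (of_real r) - 5/4 = 0 \<Longrightarrow> r\<^sub>\<psi> \<le> r"
  shows "uniformly_starlike f (min (1/3) r\<^sub>\<psi>)"
proof -
  let ?\<rho> = "min (1/3) r\<^sub>\<psi>"
  have hol: "h holomorphic_on ball 0 1" "g holomorphic_on ball 0 1"
    and f: "\<And>z. z \<in> ball 0 1 \<Longrightarrow> f z = h z + cnj (g z)" "h 0 = 0" "g 0 = 0"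
    using assms(2) by (auto simp: SH0_def)
  \<comment> \<open>The majorant is taken at the fixed radius \<open>r\<^sub>\<psi>\<close>, where
    it equals \<open>5/4 - 1\<close>.\<close>
  have h': "cmod (deriv h z - 1) \<le> 1/4" if "z \<in> ball 0 ?\<rho>" for z
  proof -
    have "deriv (h_psi \<psi>) (of_real r\<^sub>\<psi>) = of_real (5/4)" using assms(7) by simp
    then have "cmod (deriv (h_psi \<psi>) (of_real r\<^sub>\<psi>)) = 5/4" by (simp only: norm_of_real)
    then show ?thesis
      using S_star_deriv_bound[OF assms(1,3,6), of z] that by simp
  qed
  \<comment> \<open>The radius 1/3 enters through the Schwarz factor:
    \<open>1/3 * 5/4 = 5/12\<close>.\<close>
  have g': "cmod (deriv g z) \<le> 5/12" if z: "z \<in> ball 0 ?\<rho>" for z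
  proof -
    have "cmod (deriv h z) \<le> 5/4"
      using norm_triangle_sub[of "deriv h z" 1] h'[OF z] by simp
    then have "cmod z * cmod (deriv h z) \<le> 1/3 * (5/4)"
      using z by (intro mult_mono) auto
    then show ?thesis using SH0_dilatation[OF assms(2), of z] z by simp
  qed
  have sub: "ball 0 ?\<rho> \<subseteq> ball (0::complex) 1" by auto
  interpret close_to_identity f h g ?\<rho>
    using holomorphic_on_subset[OF hol(1) sub] holomorphic_on_subset[OF hol(2) sub] h' g' f sub
    by unfold_locales auto
  show ?thesis by (rule uniformly_starlike)
qed

end
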